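(* For every integer $n\ge 16$, \[ av_{opt}(n)\ \ge\ n+\frac{n}{16\log_2 n}-\frac32 . \]
   Context: A stack of $n$ burnt pancakes is a pair $C=(\pi,v)$ with $\pi\in S_n$ and $v\in\{0,1\}^n$: the $i$-th pancake from the top has size $\pi(i)$ and lies burnt side down if $v_i=0$, burnt side up if $v_i=1$. An $i$-flip reverses the order of the top $i$ pancakes and switches the orientation of each of them. $I_n$ is the stack with pancakes $1,\dots,n$ from top to bottom, all burnt side down. $g(C)$ is the minimum number of flips needed to transform $C$ into $I_n$. $av_{opt}(n)$ is the average of $g(C)$ over all $n!\,2^n$ stacks $C$ of $n$ burnt pancakes, i.e. the average number of flips of an optimal sorting algorithm. *)

theory Defs
  imports Complex_Main "HOL-Library.FuncSet" "HOL-Combinatorics.Permutations"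
begin

text \<open>
  Positions are numbered from the top and sizes by rank, both from 1. In a stack \<open>(\<pi>, v)\<close>,
  \<open>\<pi> j\<close> is the size of the pancake at position \<open>j\<close>, and \<open>v j\<close> is its orientation: \<open>0\<close> for burnt
  side down, \<open>1\<close> for burnt side up. Outside \<open>{1..n}\<close>, \<open>\<pi>\<close> is the identity and \<open>v\<close> is \<open>undefined\<close>,
  so every stack of \<open>n\<close> pancakes has exactly one representation.
\<close>

type_synonym stack = "(nat \<Rightarrow> nat) \<times> (nat \<Rightarrow> nat)"

definition stacks :: "nat \<Rightarrow> stack set" where
  "stacks n = {\<pi>. \<pi> permutes {1..n}} \<times> ({1..n} \<rightarrow>\<^sub>E {0, 1})"

definition flip :: "nat \<Rightarrow> stack \<Rightarrow> stack" where
  "flip i C = (case C of (\<pi>, v) \<Rightarrow>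
     (\<lambda>j. if j \<in> {1..i} then \<pi> (i + 1 - j) else \<pi> j,
      \<lambda>j. if j \<in> {1..i} then 1 - v (i + 1 - j) else v j))"

definition sorted_stack :: "nat \<Rightarrow> stack" where
  "sorted_stack n = (id, restrict (\<lambda>_. 0) {1..n})"

definition min_flips :: "nat \<Rightarrow> stack \<Rightarrow> nat" where
  "min_flips n C = (LEAST k. \<exists>is. length is = k \<and> set is \<subseteq> {1..n} \<and> fold flip is C = sorted_stack n)"

definition av_opt :: "nat \<Rightarrow> real" where
  "av_opt n = (\<Sum>C\<in>stacks n. real (min_flips n C)) / (fact n * 2 ^ n)"

lemma finite_stacks: "finite (stacks n)"
  unfolding stacks_def by (intro finite_cartesian_product finite_permutations finite_PiE) auto

lemma card_stacks: "card (stacks n) = fact n * 2 ^ n"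
proof -
  have "card {\<pi>. \<pi> permutes {1..n}} = fact n"
    by (rule card_permutations) auto
  moreover have "card ({1..n} \<rightarrow>\<^sub>E {0, 1::nat}) = 2 ^ n"
  proof -
    have "card {0, 1::nat} = 2" by simp
    then show ?thesis
      by (subst card_PiE) (simp_all only: finite_atLeastAtMost prod_constant
        card_atLeastAtMost Suc_eq_plus1 diff_add_inverse2)
  qed
  ultimately show ?thesis
    unfolding stacks_def by (simp add: card_cartesian_product)
qed

lemma sorted_stack_in_stacks: "sorted_stack n \<in> stacks n"
  by (auto simp: sorted_stack_def stacks_def permutes_id)

lemma flip_in_stacks:
  assumes "C \<in> stacks n" and "i \<in> {1..n}"
  shows "flip i C \<in> stacks n"
proof -
  obtain \<pi> v where C: "C = (\<pi>, v)" by (cases C)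
  from assms(1) have p: "\<pi> permutes {1..n}" and v: "v \<in> {1..n} \<rightarrow>\<^sub>E {0, 1}"
    by (auto simp: C stacks_def)
  define r where "r = (\<lambda>j. if j \<in> {1..i} then i + 1 - j else j)"
  have [simp]: "r (r j) = j" for j
    by (auto simp: r_def)
  have "r j \<in> {1..n}" if "j \<in> {1..n}" for j
    using assms(2) that by (auto simp: r_def)
  then have "bij_betw r {1..n} {1..n}"
    by (intro bij_betw_byWitness[where f' = r]) auto
  then have "r permutes {1..n}"
    by (rule bij_imp_permutes) (use assms(2) r_def in auto)
  then have "\<pi> \<circ> r permutes {1..n}"
    using p by (rule permutes_compose)
  moreover have "(\<lambda>j. if j \<in> {1..i} then \<pi> (i + 1 - j) else \<pi> j) = \<pi> \<circ> r"
    by (auto simp: r_def)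
  moreover have "(\<lambda>j. if j \<in> {1..i} then 1 - v (i + 1 - j) else v j) \<in> {1..n} \<rightarrow>\<^sub>E {0, 1}"
  proof (rule PiE_I)
    fix j assume "j \<in> {1..n}"
    then have "v j \<in> {0, 1}" using v by auto
    then show "(if j \<in> {1..i} then 1 - v (i + 1 - j) else v j) \<in> {0, 1}" by auto
  next
    fix j assume "j \<notin> {1..n}"
    then show "(if j \<in> {1..i} then 1 - v (i + 1 - j) else v j) = undefined"
      using PiE_arb[OF v \<open>j \<notin> {1..n}\<close>] assms(2) by (cases "j \<in> {1..i}") auto
  qed
  ultimately show ?thesis
    unfolding C flip_def stacks_def by simp
qed

end

theory Submission
  imports Defs
begin

text \<open>
  Call a position an adjacency if the pancakes there and directly below fit together as in the
  sorted stack, the table counting as a pancake of size \<open>n + 1\<close>, so that the sorted stack has \<open>n\<close>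
  adjacencies. A flip changes the number of adjacencies by at most one; if it does not raise it, it
  is wasted. A sorting sequence with \<open>w\<close> wasted flips that starts with \<open>a\<close> adjacencies therefore has
  length at least \<open>n - a + w\<close>. The average of \<open>a\<close> is at most 1, because from each stack at most one
  flip can create an adjacency.

  Few stacks have small \<open>w\<close>: going backwards from the sorted stack, a useful flip has to cut an
  adjacency, so there are only as many choices for it as there are adjacencies, while a wasted flip
  has \<open>n\<close> choices. Without waste this reaches at most \<open>n! / a!\<close> stacks with \<open>a\<close> adjacencies, and each
  wasted flip costs a further factor of at most \<open>n (n + 1)\<^sup>2 \<le> n\<^sup>4\<close>. As there are
  \<open>n! 2\<^sup>n\<close> stacks, at least half of them need about \<open>n / (8 log\<^sub>2 n)\<close> wasted flips.
\<close>

section \<open>Adjacencies and the effect of one flip\<close>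

text \<open>The second disjunct is the same fit turned upside down. At \<open>i = n\<close> the
  table has size \<open>n + 1\<close> because \<open>fst C\<close> is the identity outside
  \<open>{1..n}\<close>; its orientation is \<open>undefined\<close>, hence the guard
  \<open>i < n\<close>.\<close>

definition adjs :: "nat \<Rightarrow> stack \<Rightarrow> nat set" where
  "adjs n C = {i \<in> {1..n}.
     snd C i = 0 \<and> fst C (Suc i) = Suc (fst C i) \<and> (i < n \<longrightarrow> snd C (Suc i) = 0) \<or>
     snd C i = 1 \<and> fst C i = Suc (fst C (Suc i)) \<and> (i < n \<longrightarrow> snd C (Suc i) = 1)}"

lemma finite_adjs [simp]: "finite (adjs n C)"
  by (simp add: adjs_def)

lemma adjs_subset: "adjs n C \<subseteq> {1..n}"
  by (auto simp: adjs_def)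

lemma card_adjs_le: "card (adjs n C) \<le> n"
  using card_mono[OF _ adjs_subset, of n C] by simp

lemma adjs_sorted_stack: "adjs n (sorted_stack n) = {1..n}"
  by (auto simp: adjs_def sorted_stack_def)

lemma fst_flip: "fst (flip i C) j = (if j \<in> {1..i} then fst C (i + 1 - j) else fst C j)"
  by (simp add: flip_def split: prod.split)

lemma snd_flip: "snd (flip i C) j = (if j \<in> {1..i} then 1 - snd C (i + 1 - j) else snd C j)"
  by (simp add: flip_def split: prod.split)

lemma stacks_fst: "C \<in> stacks n \<Longrightarrow> fst C permutes {1..n}"
  by (auto simp: stacks_def)

lemma stacks_snd: "C \<in> stacks n \<Longrightarrow> j \<in> {1..n} \<Longrightarrow> snd C j = 0 \<or> snd C j = 1"
  by (auto simp: stacks_def PiE_def Pi_def)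

lemma stacks_snd_outside: "C \<in> stacks n \<Longrightarrow> j \<notin> {1..n} \<Longrightarrow> snd C j = undefined"
  by (auto simp: stacks_def PiE_def extensional_def)

lemma flip_flip:
  assumes "C \<in> stacks n" and "i \<in> {1..n}"
  shows "flip i (flip i C) = C"
proof (rule prod_eqI)
  show "fst (flip i (flip i C)) = fst C"
    by (rule ext) (auto simp: fst_flip)
  show "snd (flip i (flip i C)) = snd C"
  proof
    fix j
    have "snd C j = 0 \<or> snd C j = 1" if "j \<in> {1..i}"
      using assms that by (intro stacks_snd) auto
    then show "snd (flip i (flip i C)) j = snd C j"
      by (auto simp: snd_flip)
  qed
qed

text \<open>The flip turns an adjacency at \<open>j < i\<close> upside down and moves it to
  \<open>i - j\<close>, and leaves those below \<open>i\<close> alone. Only the junction at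
  \<open>i\<close> is cut.\<close>

lemma card_adjs_flip_minus_le:
  assumes "C \<in> stacks n" and "i \<in> {1..n}"
  shows "card (adjs n C - {i}) \<le> card (adjs n (flip i C) - {i})"
proof (rule card_inj_on_le)
  let ?r = "\<lambda>j. if j < i then i - j else j"
  show "inj_on ?r (adjs n C - {i})"
    by (rule inj_onI) (auto simp: adjs_def split: if_splits)
  show "?r ` (adjs n C - {i}) \<subseteq> adjs n (flip i C) - {i}"
  proof
    fix k assume "k \<in> ?r ` (adjs n C - {i})"
    then obtain j where j: "j \<in> adjs n C" "j \<noteq> i" "k = ?r j" by blast
    show "k \<in> adjs n (flip i C) - {i}"
    proof (cases "j < i")
      case True
      have "Suc i - (i - j) = Suc j" "Suc i - Suc (i - j) = j"
        using True j(1) by (auto simp: adjs_def)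
      with True j assms(2) show ?thesis
        by (auto simp: adjs_def fst_flip snd_flip)
    next
      case False
      with j show ?thesis
        by (auto simp: adjs_def fst_flip snd_flip)
    qed
  qed
qed simp

lemma card_adjs_flip_minus:
  assumes "C \<in> stacks n" and "i \<in> {1..n}"
  shows "card (adjs n (flip i C) - {i}) = card (adjs n C - {i})"
  using card_adjs_flip_minus_le[OF assms]
    card_adjs_flip_minus_le[OF flip_in_stacks[OF assms] assms(2)]
  by (simp add: flip_flip[OF assms])

lemma card_adjs_flip_cases:
  assumes "C \<in> stacks n" and "i \<in> {1..n}"
  shows "card (adjs n (flip i C)) = Suc (card (adjs n C)) \<and> i \<in> adjs n (flip i C) \<or>
    card (adjs n (flip i C)) = card (adjs n C) \<or>
    Suc (card (adjs n (flip i C))) = card (adjs n C)"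
proof -
  have *: "card A = (if i \<in> A then Suc (card (A - {i})) else card (A - {i}))"
    if "finite A" for A
    using that card_Suc_Diff1[of A i] by auto
  show ?thesis
    using card_adjs_flip_minus[OF assms] *[OF finite_adjs[of n C]] *[OF finite_adjs[of n "flip i C"]]
    by presburger
qed

text \<open>The flip puts the top pancake directly above position \<open>i + 1\<close>. Its size and
  orientation determine the size that must lie there, and that size occurs only once.\<close>

lemma flip_creating_adjacency_unique:
  assumes C: "C \<in> stacks n" and i: "i \<in> adjs n (flip i C)" and j: "j \<in> adjs n (flip j C)"
  shows "i = j"
proof -
  have ij: "1 \<le> i" "1 \<le> j" using i j by (auto simp: adjs_def)
  have "fst C (Suc i) = fst C (Suc j)"
    using i j ij by (auto simp: adjs_def fst_flip snd_flip)
  then show ?thesis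
    using permutes_inj[OF stacks_fst[OF C]] by (auto dest: injD)
qed

lemma sum_card_adjs_le: "(\<Sum>C\<in>stacks n. card (adjs n C)) \<le> card (stacks n)"
proof -
  let ?P = "SIGMA C:stacks n. adjs n C"
  have "card ?P \<le> card (stacks n)"
  proof (rule card_inj_on_le)
    \<comment> \<open>Undoing the flip at an adjacency: the stack reached determines the flip, as at most one
      flip from it creates an adjacency.\<close>
    show "inj_on (\<lambda>(C, i). flip i C) ?P"
    proof (rule inj_onI, clarify)
      fix C i D j
      assume C: "C \<in> stacks n" "i \<in> adjs n C" and D: "D \<in> stacks n" "j \<in> adjs n D"
        and eq: "flip i C = flip j D"
      have i: "i \<in> {1..n}" and j: "j \<in> {1..n}" using C D adjs_subset by blast+
      have ffi: "flip i (flip i C) = C" and ffj: "flip j (flip j D) = D"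
        using C D i j flip_flip by blast+
      have "i = j"
        by (rule flip_creating_adjacency_unique[OF flip_in_stacks[OF C(1) i]])
          (use C D ffi ffj eq in auto)
      with ffi ffj eq show "C = D \<and> i = j" by metis
    qed
    show "(\<lambda>(C, i). flip i C) ` ?P \<subseteq> stacks n"
      using adjs_subset flip_in_stacks by fastforce
  qed (rule finite_stacks)
  then show ?thesis by (simp add: finite_stacks)
qed

section \<open>Sorting sequences and their wasted flips\<close>

text \<open>\<open>sortable n w C\<close>: some sorting sequence for \<open>C\<close> has exactly \<open>w\<close> wasted flips.\<close>
inductive sortable :: "nat \<Rightarrow> nat \<Rightarrow> stack \<Rightarrow> bool" for n where
  sorted: "sortable n 0 (sorted_stack n)"
| gain: "C \<in> stacks n \<Longrightarrow> i \<in> {1..n} \<Longrightarrow> sortable n w (flip i C) \<Longrightarrow>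
    card (adjs n (flip i C)) = Suc (card (adjs n C)) \<Longrightarrow> i \<in> adjs n (flip i C) \<Longrightarrow> sortable n w C"
| waste: "C \<in> stacks n \<Longrightarrow> i \<in> {1..n} \<Longrightarrow> sortable n w (flip i C) \<Longrightarrow>
    card (adjs n (flip i C)) = card (adjs n C) \<or> card (adjs n (flip i C)) = card (adjs n C) - 1 \<Longrightarrow>
    sortable n (Suc w) C"

text \<open>Each flip adds one to the length. A gain pays for one of the missing adjacencies, any
  other flip pays for one unit of waste; losing an adjacency only leaves slack.\<close>

lemma sorting_sequence_sortable:
  assumes "C \<in> stacks n" and "set is \<subseteq> {1..n}" and "fold flip is C = sorted_stack n"
  shows "\<exists>w. sortable n w C \<and> n + w \<le> card (adjs n C) + length is"
  using assms
proof (induction "is" arbitrary: C)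
  case Nil
  then show ?case
    by (auto intro!: exI[of _ 0] sortable.sorted simp: adjs_sorted_stack)
next
  case (Cons i "is")
  have i: "i \<in> {1..n}" using Cons.prems by simp
  obtain w where w: "sortable n w (flip i C)"
      "n + w \<le> card (adjs n (flip i C)) + length is"
    using Cons.IH[of "flip i C"] Cons.prems flip_in_stacks by auto
  from card_adjs_flip_cases[OF Cons.prems(1) i] consider
    (g) "card (adjs n (flip i C)) = Suc (card (adjs n C))" "i \<in> adjs n (flip i C)"
  | (w) "card (adjs n (flip i C)) = card (adjs n C)
      \<or> Suc (card (adjs n (flip i C))) = card (adjs n C)" by blast
  then show ?case
  proof cases
    case g
    then have "sortable n w C" by (intro sortable.gain[OF Cons.prems(1) i w(1)])
    then show ?thesis using g w(2) by (intro exI[of _ w]) auto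
  next
    case w: w
    then have "sortable n (Suc w) C"
      by (intro sortable.waste[OF Cons.prems(1) i \<open>sortable n w (flip i C)\<close>]) auto
    then show ?thesis
      using w \<open>n + w \<le> _\<close> by (intro exI[of _ "Suc w"]) auto
  qed
qed

text \<open>Ensures that the \<open>LEAST\<close> in \<open>min_flips\<close> is attained. The
  largest unplaced pancake is brought to the top and then flipped down to its place.\<close>

lemma ex_sorting_sequence_unsorted_top:
  assumes "C \<in> stacks n" and "k \<le> n" and "\<And>j. k < j \<Longrightarrow> j \<le> n \<Longrightarrow> fst C j = j \<and> snd C j = 0"
  shows "\<exists>is. set is \<subseteq> {1..n} \<and> fold flip is C = sorted_stack n"
  using assms
proof (induction k arbitrary: C)
  case 0
  have "fst C j = j" for j
    using 0 permutes_not_in[OF stacks_fst[OF 0(1)], of j] by (cases "j \<in> {1..n}") auto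
  moreover have "snd C j = restrict (\<lambda>_. 0) {1..n} j" for j
    using 0 stacks_snd_outside[OF 0(1), of j] by (cases "j \<in> {1..n}") auto
  ultimately have "C = sorted_stack n"
    by (auto simp: sorted_stack_def intro!: prod_eqI)
  then show ?case by (intro exI[of _ "[]"]) auto
next
  case (Suc k)
  note perm = stacks_fst[OF Suc.prems(1)]
  obtain j where j: "fst C j = Suc k"
    using permutes_surj[OF perm] by (metis surjD)
  have j1: "j \<in> {1..n}"
    using j Suc.prems(2) permutes_in_image[OF perm, of j] by auto
  have jk: "j \<le> Suc k"
    using Suc.prems(3)[of j] j j1 by (cases "Suc k < j") auto
  define D where "D = flip j C"
  \<comment> \<open>The last flip reverses the orientation, so the top pancake must first be burnt
    side up.\<close>
  define E where "E = (if snd D 1 = 0 then flip 1 D else D)"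
  define F where "F = flip (Suc k) E"
  have D: "D \<in> stacks n" unfolding D_def by (rule flip_in_stacks[OF Suc.prems(1) j1])
  have E: "E \<in> stacks n" unfolding E_def using flip_in_stacks[OF D] Suc.prems(2) D by auto
  have F: "F \<in> stacks n" unfolding F_def using flip_in_stacks[OF E] Suc.prems(2) by auto
  have "fst D 1 = Suc k" using j j1 by (auto simp: D_def fst_flip)
  then have E1: "fst E 1 = Suc k" "snd E 1 = 1"
    using stacks_snd[OF D, of 1] Suc.prems(2) by (auto simp: E_def fst_flip snd_flip)
  have "fst F l = l \<and> snd F l = 0" if "k < l" "l \<le> n" for l
  proof (cases "l = Suc k")
    case True
    then show ?thesis using E1 by (auto simp: F_def fst_flip snd_flip)
  next
    case False
    then show ?thesis using Suc.prems(3)[of l] that jk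
      by (auto simp: F_def E_def D_def fst_flip snd_flip)
  qed
  then obtain "is" where "is": "set is \<subseteq> {1..n}" "fold flip is F = sorted_stack n"
    using Suc.IH[OF F] Suc.prems(2) by auto
  define ks where "ks = (if snd D 1 = 0 then [j, 1, Suc k] else [j, Suc k])"
  have "fold flip (ks @ is) C = sorted_stack n"
    using "is"(2) by (cases "snd D 1 = 0") (simp_all add: ks_def F_def E_def D_def)
  moreover have "set (ks @ is) \<subseteq> {1..n}"
    using "is"(1) j1 Suc.prems(2) by (auto simp: ks_def)
  ultimately show ?case by blast
qed

lemma min_flips_attained:
  assumes "C \<in> stacks n"
  obtains "is" where "length is = min_flips n C" "set is \<subseteq> {1..n}" "fold flip is C = sorted_stack n"
proof -
  have "\<exists>k is. length is = k \<and> set is \<subseteq> {1..n} \<and> fold flip is C = sorted_stack n"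
    using ex_sorting_sequence_unsorted_top[OF assms, of n] by auto
  from LeastI_ex[OF this] show ?thesis
    unfolding min_flips_def[symmetric] using that by blast
qed

section \<open>Counting stacks by waste and adjacencies\<close>

definition level :: "nat \<Rightarrow> nat \<Rightarrow> nat \<Rightarrow> stack set" where
  "level n w a = {C \<in> stacks n. sortable n w C \<and> card (adjs n C) = a}"

lemma finite_level [simp]: "finite (level n w a)"
  using finite_stacks by (simp add: level_def)

lemma level_empty: "n < a \<Longrightarrow> level n w a = {}"
  using card_adjs_le by (auto simp: level_def dest: leD)

text \<open>Backward moves: a flip is its own inverse, so a stack whose next flip gains an adjacency
  at \<open>i\<close> arises from the resulting stack by cutting at \<open>i\<close>.\<close>

definition gained :: "nat \<Rightarrow> nat \<Rightarrow> nat \<Rightarrow> stack set" where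
  "gained n w a = (\<lambda>(D, i). flip i D) ` (SIGMA D:level n w (Suc a). adjs n D)"

definition wasted :: "nat \<Rightarrow> nat \<Rightarrow> nat \<Rightarrow> stack set" where
  "wasted n w a = (\<lambda>(D, i). flip i D) ` (level n w a \<times> {1..n})"

lemma card_gained_le: "card (gained n w a) \<le> Suc a * card (level n w (Suc a))"
proof -
  have "card (gained n w a) \<le> card (SIGMA D:level n w (Suc a). adjs n D)"
    unfolding gained_def by (rule card_image_le) auto
  also have "\<dots> = (\<Sum>D\<in>level n w (Suc a). card (adjs n D))" by simp
  also have "\<dots> = (\<Sum>D\<in>level n w (Suc a). Suc a)"
    by (rule sum.cong) (auto simp: level_def)
  finally show ?thesis by (simp add: mult.commute)
qed

lemma card_wasted_le: "card (wasted n w a) \<le> n * card (level n w a)"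
proof -
  have "card (wasted n w a) \<le> card (level n w a \<times> {1..n})"
    unfolding wasted_def by (rule card_image_le) auto
  then show ?thesis by (simp add: card_cartesian_product mult.commute)
qed

lemma finite_gained [simp]: "finite (gained n w a)"
  by (simp add: gained_def)

lemma finite_wasted [simp]: "finite (wasted n w a)"
  by (simp add: wasted_def)

lemma level_0_subset:
  "level n 0 a \<subseteq> (if a = n then {sorted_stack n} else {}) \<union> gained n 0 a"
proof
  fix C assume C: "C \<in> level n 0 a"
  then have "sortable n 0 C" by (simp add: level_def)
  then show "C \<in> (if a = n then {sorted_stack n} else {}) \<union> gained n 0 a"
  proof cases
    case sorted
    then show ?thesis using C by (auto simp: level_def adjs_sorted_stack)
  next
    case (gain i)
    then have "(flip i C, i) \<in> (SIGMA D:level n 0 (Suc a). adjs n D)"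
      using C flip_in_stacks by (auto simp: level_def)
    then have "flip i (flip i C) \<in> gained n 0 a" unfolding gained_def by force
    then show ?thesis using gain flip_flip by auto
  qed
qed

text \<open>The wasted flip leads to \<open>a\<close> or to \<open>a - 1\<close> adjacencies; for
  \<open>a = 0\<close> the truncated subtraction makes the two sets coincide.\<close>

lemma level_Suc_subset:
  "level n (Suc w) a \<subseteq> gained n (Suc w) a \<union> (wasted n w a \<union> wasted n w (a - 1))"
proof
  fix C assume C: "C \<in> level n (Suc w) a"
  then have "sortable n (Suc w) C" by (simp add: level_def)
  then show "C \<in> gained n (Suc w) a \<union> (wasted n w a \<union> wasted n w (a - 1))"
  proof cases
    case (gain i)
    then have "(flip i C, i) \<in> (SIGMA D:level n (Suc w) (Suc a). adjs n D)"
      using C flip_in_stacks by (auto simp: level_def)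
    then have "flip i (flip i C) \<in> gained n (Suc w) a" unfolding gained_def by force
    then show ?thesis using gain flip_flip by auto
  next
    case (waste i)
    then have "(flip i C, i) \<in> level n w a \<times> {1..n} \<or> (flip i C, i) \<in> level n w (a - 1) \<times> {1..n}"
      using C flip_in_stacks by (auto simp: level_def)
    then have "flip i (flip i C) \<in> wasted n w a \<union> wasted n w (a - 1)"
      unfolding wasted_def by force
    then show ?thesis using waste flip_flip by auto
  qed
qed

text \<open>Going down from \<open>a = n\<close>, where only the sorted stack remains, the weight
  \<open>fact a\<close> absorbs the \<open>Suc a\<close> choices of a cut.\<close>

lemma card_level_0: "card (level n 0 a) * fact a \<le> fact n"
proof (cases "a \<le> n")
  case True
  then show ?thesis
  proof (induction rule: inc_induct)
    case base
    have "card (level n 0 n) \<le> card ({sorted_stack n} \<union> gained n 0 n)"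
      using level_0_subset[of n n] by (intro card_mono) auto
    also have "\<dots> \<le> 1 + card (gained n 0 n)"
      using card_Un_le[of "{sorted_stack n}"] by simp
    also have "card (gained n 0 n) = 0"
      using card_gained_le[of n 0 n] by (simp add: level_empty)
    finally show ?case by simp
  next
    case (step a)
    have "card (level n 0 a) \<le> card (gained n 0 a)"
      using level_0_subset[of n a] step by (intro card_mono) auto
    also have "\<dots> \<le> Suc a * card (level n 0 (Suc a))" by (rule card_gained_le)
    finally have "card (level n 0 a) * fact a \<le> Suc a * card (level n 0 (Suc a)) * fact a"
      by simp
    also have "\<dots> = card (level n 0 (Suc a)) * fact (Suc a)" by (simp add: algebra_simps)
    finally show ?case using step by simp
  qed
qed (simp add: level_empty)

text \<open>With the weight \<open>fact a\<close> the recursion becomes additive: starting from the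
  empty level \<open>Suc n\<close>, each step down adds at most
  \<open>n * B + n * (n * B)\<close>.\<close>

lemma card_level_Suc:
  assumes IH: "\<And>a. card (level n w a) * fact a \<le> B" and "a \<le> Suc n" "0 < n"
  shows "card (level n (Suc w) a) * fact a \<le> (Suc n - a) * (n * Suc n * B)"
  using \<open>a \<le> Suc n\<close>
proof (induction rule: inc_induct)
  case base
  then show ?case by (simp add: level_empty)
next
  case (step a)
  \<comment> \<open>Level \<open>a - 1\<close> carries the weight \<open>fact (a - 1)\<close>, so a
    flip that loses an adjacency costs an extra factor \<open>n\<close>.\<close>
  have fact: "fact a \<le> n * (fact (a - 1) :: nat)"
    using step \<open>0 < n\<close> mult_right_mono[of a n "fact (a - 1) :: nat"]
    by (cases "a = 0") (auto simp: fact_reduce)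
  have "card (level n (Suc w) a) \<le>
      card (gained n (Suc w) a \<union> (wasted n w a \<union> wasted n w (a - 1)))"
    using level_Suc_subset[of n w a] by (intro card_mono) auto
  also have "\<dots> \<le> card (gained n (Suc w) a) + (card (wasted n w a) + card (wasted n w (a - 1)))"
    by (meson add_left_mono card_Un_le order_trans)
  also have "\<dots> \<le> Suc a * card (level n (Suc w) (Suc a)) +
      (n * card (level n w a) + n * card (level n w (a - 1)))"
    by (intro add_mono card_gained_le card_wasted_le)
  finally have "card (level n (Suc w) a) * fact a \<le> (Suc a * card (level n (Suc w) (Suc a)) +
      (n * card (level n w a) + n * card (level n w (a - 1)))) * fact a"
    by simp
  also have "\<dots> = card (level n (Suc w) (Suc a)) * fact (Suc a) +
      n * (card (level n w a) * fact a) + n * (card (level n w (a - 1)) * fact a)"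
    by (simp add: algebra_simps)
  also have "\<dots> \<le> (Suc n - Suc a) * (n * Suc n * B) + n * B + n * (n * B)"
  proof (intro add_mono mult_left_mono)
    have "card (level n w (a - 1)) * fact a \<le> card (level n w (a - 1)) * (n * fact (a - 1))"
      using fact by simp
    also have "\<dots> = n * (card (level n w (a - 1)) * fact (a - 1))" by simp
    also have "\<dots> \<le> n * B" using IH by (intro mult_left_mono) auto
    finally show "card (level n w (a - 1)) * fact a \<le> n * B" .
  qed (use step IH in auto)
  also have "\<dots> = Suc (Suc n - Suc a) * (n * Suc n * B)" by (simp add: algebra_simps)
  also have "Suc (Suc n - Suc a) = Suc n - a" using step by auto
  finally show ?case .
qed

lemma card_level_le:
  assumes "0 < n"
  shows "card (level n w a) * fact a \<le> fact n * (n * Suc n ^ 2) ^ w"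
proof (induction w arbitrary: a)
  case 0
  then show ?case using card_level_0 by simp
next
  case (Suc w)
  show ?case
  proof (cases "a \<le> n")
    case True
    have "card (level n (Suc w) a) * fact a \<le>
        (Suc n - a) * (n * Suc n * (fact n * (n * Suc n ^ 2) ^ w))"
      using True assms by (intro card_level_Suc Suc.IH) auto
    also have "\<dots> \<le> Suc n * (n * Suc n * (fact n * (n * Suc n ^ 2) ^ w))"
      by (intro mult_right_mono) auto
    also have "\<dots> = fact n * (n * Suc n ^ 2) ^ Suc w"
      by (simp add: power2_eq_square algebra_simps)
    finally show ?thesis .
  qed (simp add: level_empty)
qed

text \<open>Union bound over the \<open>t * Suc n\<close> levels with \<open>w < t\<close> and
  \<open>a \<le> n\<close>.\<close>

lemma card_few_wasted_le:
  assumes "0 < n"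
  shows "card {C \<in> stacks n. \<exists>w<t. sortable n w C} \<le> t * Suc n * (fact n * (n * Suc n ^ 2) ^ (t - 1))"
proof -
  let ?B = "fact n * (n * Suc n ^ 2) ^ (t - 1)"
  have le: "card (level n w a) \<le> ?B" if "w < t" for w a
  proof -
    have "card (level n w a) \<le> card (level n w a) * fact a"
      using fact_ge_1[of a, where 'a = nat] by (cases "fact a :: nat") auto
    also have "\<dots> \<le> fact n * (n * Suc n ^ 2) ^ w" by (rule card_level_le[OF assms])
    also have "\<dots> \<le> ?B" using that assms
      by (intro mult_left_mono power_increasing) auto
    finally show ?thesis .
  qed
  have "{C \<in> stacks n. \<exists>w<t. sortable n w C} \<subseteq> (\<Union>(w, a)\<in>{..<t} \<times> {..n}. level n w a)"
    using card_adjs_le by (fastforce simp: level_def)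
  then have "card {C \<in> stacks n. \<exists>w<t. sortable n w C} \<le>
      card (\<Union>(w, a)\<in>{..<t} \<times> {..n}. level n w a)"
    by (intro card_mono) auto
  also have "\<dots> \<le> (\<Sum>(w, a)\<in>{..<t} \<times> {..n}. card (level n w a))"
    using card_UN_le[of "{..<t} \<times> {..n}" "\<lambda>(w, a). level n w a"]
    by (simp add: case_prod_beta)
  also have "\<dots> \<le> (\<Sum>(w, a)\<in>{..<t} \<times> {..n}. ?B)"
    by (intro sum_mono) (use le in auto)
  finally show ?thesis by (simp add: card_cartesian_product)
qed

text \<open>The \<open>t - 1\<close> wasted flips and the prefactor \<open>2 * (t * Suc n)\<close>
  cost at most \<open>n ^ 4\<close> each, which makes \<open>t\<close> such factors.\<close>

lemma half_few_wasted:
  assumes "n \<ge> 16" and t: "n ^ (4 * t) \<le> 2 ^ n" "t \<le> n"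
  shows "2 * card {C \<in> stacks n. \<exists>w<t. sortable n w C} \<le> card (stacks n)"
proof (cases t)
  case 0
  then show ?thesis by simp
next
  case (Suc s)
  have "Suc n ^ 2 \<le> (2 * n) ^ 2" using assms(1) by (intro power_mono) auto
  also have "\<dots> = 4 * n ^ 2" by (simp add: power_mult_distrib)
  also have "\<dots> \<le> n * n ^ 2" using assms(1) by (intro mult_right_mono) auto
  finally have "n * Suc n ^ 2 \<le> n * (n * n ^ 2)" by (intro mult_left_mono) auto
  then have M: "n * Suc n ^ 2 \<le> n ^ 4" by (simp add: power_numeral_reduce)
  have "2 * (t * Suc n) \<le> 2 * (n * (2 * n))"
    using assms by (intro mult_mono) auto
  also have "\<dots> = 4 * n ^ 2" by (simp add: power2_eq_square)
  also have "\<dots> \<le> n ^ 2 * n ^ 2"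
    using assms(1) self_le_power[of n 2] by (intro mult_right_mono) auto
  finally have N: "2 * (t * Suc n) \<le> n ^ 4" by (simp add: eval_nat_numeral)
  have "2 * card {C \<in> stacks n. \<exists>w<t. sortable n w C} \<le>
      2 * (t * Suc n * (fact n * (n * Suc n ^ 2) ^ s))"
    using card_few_wasted_le[of n t] assms(1) Suc by simp
  also have "\<dots> = 2 * (t * Suc n) * (fact n * (n * Suc n ^ 2) ^ s)" by simp
  also have "\<dots> \<le> n ^ 4 * (fact n * (n ^ 4) ^ s)"
    using N M by (intro mult_mono power_mono) auto
  also have "\<dots> = fact n * n ^ (4 * t)"
    by (simp add: Suc power_mult[symmetric] power_add)
  also have "\<dots> \<le> card (stacks n)" using t(1) by (simp add: card_stacks)
  finally show ?thesis .
qed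

section \<open>The lower bound for the average\<close>

lemma sum_min_flips_ge:
  assumes "2 * card {C \<in> stacks n. \<exists>w<t. sortable n w C} \<le> card (stacks n)"
  shows "real (card (stacks n)) * (real n - 1 + real t / 2) \<le> (\<Sum>C\<in>stacks n. real (min_flips n C))"
proof -
  let ?S = "stacks n" and ?Few = "{C \<in> stacks n. \<exists>w<t. sortable n w C}"
  \<comment> \<open>On \<open>?Few\<close> the last summand cancels \<open>t\<close>, leaving
    \<open>n\<close> as a bound for flips plus adjacencies.\<close>
  have pointwise: "real n + real t \<le>
      real (min_flips n C) + real (card (adjs n C)) + (if C \<in> ?Few then real t else 0)"
    if C: "C \<in> ?S" for C
  proof -
    obtain "is" where "length is = min_flips n C" "set is \<subseteq> {1..n}" "fold flip is C = sorted_stack n"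
      using min_flips_attained[OF C] .
    with sorting_sequence_sortable[OF C] obtain w
      where w: "sortable n w C" "n + w \<le> card (adjs n C) + min_flips n C"
      by metis
    have "t \<le> w" if "C \<notin> ?Few" using that w(1) C by (auto simp: not_less)
    then show ?thesis using w(2) by (cases "C \<in> ?Few") auto
  qed
  have "real (card ?S) * (real n + real t) = (\<Sum>C\<in>?S. real n + real t)" by simp
  also have "\<dots> \<le> (\<Sum>C\<in>?S. real (min_flips n C) + real (card (adjs n C)) +
      (if C \<in> ?Few then real t else 0))"
    by (intro sum_mono pointwise)
  also have "\<dots> = (\<Sum>C\<in>?S. real (min_flips n C)) + real (\<Sum>C\<in>?S. card (adjs n C)) +
      real (card ?Few) * real t"
    by (simp add: sum.distrib sum.If_cases finite_stacks Int_def conj_commute)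
  also have "real (\<Sum>C\<in>?S. card (adjs n C)) \<le> real (card ?S)"
    using sum_card_adjs_le[of n] of_nat_mono by blast
  also have "real (card ?Few) * real t \<le> real (card ?S) / 2 * real t"
    using of_nat_mono[OF assms, where 'a = real] by (intro mult_right_mono) auto
  finally show ?thesis by (simp add: algebra_simps)
qed

theorem theorem2:
  fixes n :: nat
  assumes "n \<ge> 16"
  shows "av_opt n \<ge> real n + real n / (16 * log 2 (real n)) - 3 / 2"
proof -
  define L where "L = log 2 (real n)"
  have L: "L \<ge> 1" using assms by (simp add: L_def le_log_iff)
  \<comment> \<open>At least half of the stacks waste \<open>t\<close> flips or more, so
    \<open>t / 2\<close> must be close to \<open>n / (16 * L)\<close>. This choice also gives
    \<open>4 * t * L \<le> n\<close>, that is, \<open>n ^ (4 * t) \<le> 2 ^ n\<close>.\<close>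
  define t where "t = nat \<lfloor>real n / (8 * L)\<rfloor>"
  have t: "real t \<le> real n / (8 * L)" "real n / (8 * L) < real t + 1"
    using L unfolding t_def by auto
  have "real n / (8 * L) \<le> real n / 1" using L by (intro divide_left_mono) auto
  with t(1) have tn: "t \<le> n" by simp
  have "8 * L * real t \<le> real n" using t(1) L by (simp add: field_simps)
  then have "L * real (4 * t) \<le> real n" using L by simp
  then have "2 powr (L * real (4 * t)) \<le> 2 powr real n" by (intro powr_mono) auto
  moreover have "2 powr (L * real (4 * t)) = real n ^ (4 * t)"
    using assms by (simp add: L_def powr_powr[symmetric] powr_realpow flip: power_mult)
  ultimately have "real (n ^ (4 * t)) \<le> real (2 ^ n)"
    by (simp add: powr_realpow)
  then have "n ^ (4 * t) \<le> 2 ^ n" by (simp only: of_nat_le_iff)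
  from sum_min_flips_ge[OF half_few_wasted[OF assms this tn]]
  have "real n - 1 + real t / 2 \<le> av_opt n"
    unfolding av_opt_def card_stacks by (simp add: field_simps)
  \<comment> \<open>Rounding \<open>t\<close> down costs at most \<open>1 / 2\<close>; with the
    average of at most 1 adjacency this makes the \<open>3 / 2\<close>.\<close>
  moreover have "real n / (16 * L) \<le> real t / 2 + 1 / 2"
    using t(2) L by (simp add: field_simps)
  ultimately show ?thesis unfolding L_def by linarith
qed

end
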